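(* (1) There is a family $\mathcal{F}$ of $5$-element subsets of $[10]=\{1,\dots,10\}$ such that $|\mathcal{F}|=\frac12\binom{10}{5}=126$, $\mathcal{F}$ has no balanced subsets of size $2$ or $4$, but $\mathcal{F}$ does have a balanced subset of size $6$. (2) There is a maximal frame $([10],\mathcal{M})$ which is incoherent and has index $6$.
   Context: A family $\mathcal{F}$ of subsets of $[2n]=\{1,\dots,2n\}$ is balanced if every $i\in[2n]$ belongs to the same number of elements of $\mathcal{F}$. A finite social decision frame is a pair $(W,\mathcal{M})$ where $W$ is a nonempty finite set and $\mathcal{M}$ is a family of subsets of $W$. Put $A^c=W\setminus A$ and $\mathcal{H}=\{A\subseteq W: A\notin\mathcal{M}\text{ and }A^c\notin\mathcal{M}\}$. For $k\ge 1$ and $A_1,\dots,A_k\subseteq W$ (repetitions allowed), $\varphi_k(A_1,\dots,A_k)$ is the statement: if all $A_i\in\mathcal{M}\cup\mathcal{H}$ and every $w\in W$ belongs to at most $k/2$ of the sets $A_1,\dots,A_k$ (counted with repetition), then all $A_i\in\mathcal{H}$ and every $w\in W$ belongs to exactly $k/2$ of them. The frame is coherent if $\varphi_k(A_1,\dots,A_k)$ holds for all $k\geq 1$ and all $A_1,\dots,A_k\subseteq W$, and incoherent otherwise. The index of an incoherent frame is the smallest $k$ such that $\varphi_k(A_1,\dots,A_k)$ fails for some $A_1,\dots,A_k$. A frame $([2n],\mathcal{M})$ is standard if $\mathcal{M}$ contains all subsets of $[2n]$ of size $>n$ and every set in $\mathcal{M}$ has size $\ge n$; then $\mathcal{M}_n=\{A\in\mathcal{M}:|A|=n\}$.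 A standard frame is maximal if there is no $A$ such that both $A$ and $A^c$ are in $\mathcal{M}_n$, and $\mathcal{H}=\varnothing$. *)

theory Defs imports Complex_Main begin

definition balanced :: "nat \<Rightarrow> nat set set \<Rightarrow> bool" where
  "balanced n F \<longleftrightarrow> F \<subseteq> Pow {1..2*n} \<and>
     (\<exists>c. \<forall>i\<in>{1..2*n}. card {A \<in> F. i \<in> A} = c)"

definition decision_frame :: "'a set \<Rightarrow> 'a set set \<Rightarrow> bool" where
  "decision_frame W M \<longleftrightarrow> finite W \<and> W \<noteq> {} \<and> M \<subseteq> Pow W"

definition undecided :: "'a set \<Rightarrow> 'a set set \<Rightarrow> 'a set set" where
  "undecided W M = {A. A \<subseteq> W \<and> A \<notin> M \<and> W - A \<notin> M}"

text \<open>The sets \<open>A 1, \<dots>, A k\<close> form an indexed family, so repetitions are counted.\<close>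

definition phi :: "'a set \<Rightarrow> 'a set set \<Rightarrow> nat \<Rightarrow> (nat \<Rightarrow> 'a set) \<Rightarrow> bool" where
  "phi W M k A \<longleftrightarrow>
     ((\<forall>i\<in>{1..k}. A i \<in> M \<union> undecided W M) \<and>
      (\<forall>w\<in>W. real (card {i\<in>{1..k}. w \<in> A i}) \<le> real k / 2)
      \<longrightarrow>
      (\<forall>i\<in>{1..k}. A i \<in> undecided W M) \<and>
      (\<forall>w\<in>W. real (card {i\<in>{1..k}. w \<in> A i}) = real k / 2))"

definition coherent :: "'a set \<Rightarrow> 'a set set \<Rightarrow> bool" where
  "coherent W M \<longleftrightarrow>
     (\<forall>k\<ge>1. \<forall>A. (\<forall>i\<in>{1..k}. A i \<subseteq> W) \<longrightarrow> phi W M k A)"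

text \<open>Meaningful only for incoherent frames; otherwise the \<open>LEAST\<close> is unspecified.\<close>

definition frame_index :: "'a set \<Rightarrow> 'a set set \<Rightarrow> nat" where
  "frame_index W M =
     (LEAST k. k \<ge> 1 \<and> (\<exists>A. (\<forall>i\<in>{1..k}. A i \<subseteq> W) \<and> \<not> phi W M k A))"

definition standard_frame :: "nat \<Rightarrow> nat set set \<Rightarrow> bool" where
  "standard_frame n M \<longleftrightarrow> decision_frame {1..2*n} M \<and>
     (\<forall>A. A \<subseteq> {1..2*n} \<and> card A > n \<longrightarrow> A \<in> M) \<and>
     (\<forall>A\<in>M. card A \<ge> n)"

definition level :: "nat \<Rightarrow> nat set set \<Rightarrow> nat set set" where
  "level n M = {A \<in> M. card A = n}"

definition maximal_frame :: "nat \<Rightarrow> nat set set \<Rightarrow> bool" where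
  "maximal_frame n M \<longleftrightarrow> standard_frame n M \<and>
     \<not> (\<exists>A. A \<in> level n M \<and> {1..2*n} - A \<in> level n M) \<and>
     undecided {1..2*n} M = {}"

end

theory Submission imports Defs begin

text \<open>
  Let the elements of \<open>{1..10}\<close> be the blocks of a 2-(6,3,2) design, and assign to each of the
  six points the set of the five blocks through it. Every block has three
  points, so the six sets are balanced. Choose weights on \<open>{1..10}\<close> for which,
  up to complements, exactly these six 5-sets have half of the total weight, and break all
  other complementary pairs in favour of the heavier set. The members of a balanced
  subfamily have on average half of the total weight, so they all are among the six; as the
  incidence matrix of the design has full rank, the six must occur equally often.
\<close>

section \<open>Double counting in indexed families\<close>

text \<open>Both sides add \<open>f w\<close> over all incidences \<open>w \<in> A i\<close>.
  Constant \<open>f\<close> gives cardinalities, \<open>weight\<close> gives weights.\<close>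

lemma sum_weighted_multiplicity:
  fixes f :: "'a \<Rightarrow> 'b :: semiring_1"
  assumes "finite K" "finite W" "\<And>i. i \<in> K \<Longrightarrow> A i \<subseteq> W"
  shows "(\<Sum>w\<in>W. of_nat (card {i\<in>K. w \<in> A i}) * f w) = (\<Sum>i\<in>K. sum f (A i))"
proof -
  have "(\<Sum>w\<in>W. of_nat (card {i\<in>K. w \<in> A i}) * f w) = (\<Sum>w\<in>W. \<Sum>i\<in>K. if w \<in> A i then f w else 0)"
    using assms(1) by (simp flip: sum.inter_filter)
  also have "\<dots> = (\<Sum>i\<in>K. \<Sum>w\<in>W. if w \<in> A i then f w else 0)"
    by (rule sum.swap)
  also have "\<dots> = (\<Sum>i\<in>K. sum f (A i))"
  proof (rule sum.cong)
    fix i assume "i \<in> K"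
    then have "{w\<in>W. w \<in> A i} = A i" using assms(3) by blast
    then show "(\<Sum>w\<in>W. if w \<in> A i then f w else 0) = sum f (A i)"
      using assms(2) by (simp flip: sum.inter_filter)
  qed simp
  finally show ?thesis .
qed

text \<open>Grouping indices by value turns a multiplicity in a family with repetitions into a
  linear form in the numbers of occurrences.\<close>

lemma card_multiplicity_by_value:
  assumes "finite K" "finite S" "\<And>i. i \<in> K \<Longrightarrow> A i \<in> S"
  shows "card {i\<in>K. P (A i)} = (\<Sum>s\<in>S. if P s then card {i\<in>K. A i = s} else 0)"
proof -
  have "A ` {i\<in>K. P (A i)} \<subseteq> S" using assms(3) by auto
  then have "card {i\<in>K. P (A i)} = (\<Sum>s\<in>S. \<Sum>i | i \<in> {i\<in>K. P (A i)} \<and> A i = s. 1)"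
    using sum.group[of "{i\<in>K. P (A i)}" S A "\<lambda>_. 1 :: nat"] assms(1,2) by simp
  also have "\<dots> = (\<Sum>s\<in>S. if P s then card {i\<in>K. A i = s} else 0)"
    by (rule sum.cong) (auto intro!: arg_cong[of _ _ card] simp: card_eq_0_iff)
  finally show ?thesis .
qed

section \<open>Executable search for sublists\<close>

text \<open>\<open>s\<close> is the sum still missing. Only hits are kept, so evaluation never
  builds the list of all sublists.\<close>

fun sublists_with_sum :: "('a \<Rightarrow> int) \<Rightarrow> 'a list \<Rightarrow> nat \<Rightarrow> int \<Rightarrow> 'a list list" where
  "sublists_with_sum f xs 0 s = (if s = 0 then [[]] else [])"
| "sublists_with_sum f [] (Suc k) s = []"
| "sublists_with_sum f (x # xs) (Suc k) s =
     map ((#) x) (sublists_with_sum f xs k (s - f x)) @ sublists_with_sum f xs (Suc k) s"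

text \<open>Completeness of the search, on which an exhaustive check rests.\<close>

lemma mem_sublists_with_sum:
  "xs \<in> set (subseqs ys) \<Longrightarrow> length xs = k \<Longrightarrow> sum_list (map f xs) = s \<Longrightarrow> xs \<in> set (sublists_with_sum f ys k s)"
  by (induction f ys k s arbitrary: xs rule: sublists_with_sum.induct)
    (auto simp: Let_def)

section \<open>The weights and the design\<close>

text \<open>
  A vector orthogonal to the \<open>\<plusminus>1\<close>-vectors of the six design sets, found by computer search so
  that no 5-sets other than these and their complements reach half of the total. The entry at
  index \<open>0\<close> is a dummy.
\<close>

definition weight :: "nat \<Rightarrow> int" where
  "weight i = [0, 9, 22, 12, 0, 17, 8, 7, 14, 10, 21] ! i"

text \<open>The entries increase, as in the sublists found by the search, so that hits can be
  compared with the design as lists.\<close>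

definition design_lists :: "nat list list" where
  "design_lists = [[1,2,3,4,5], [1,2,6,7,8], [1,3,6,9,10], [2,4,7,9,10], [3,5,7,8,9], [4,5,6,8,10]]"

definition design_sets :: "nat set set" where
  "design_sets = set (map set design_lists)"

text \<open>60 is half of the total weight; a tied complementary pair is decided in favour of its
  design set.\<close>

definition heavy5 :: "nat set set" where
  "heavy5 = {A. A \<subseteq> {1..10} \<and> card A = 5 \<and> (sum weight A > 60 \<or> A \<in> design_sets)}"

definition heavy :: "nat set set" where
  "heavy = {A. A \<subseteq> {1..10} \<and> card A > 5} \<union> heavy5"

lemma atLeastAtMost_1_10: "{1..10::nat} = {1,2,3,4,5,6,7,8,9,10}"
  by (auto simp: numeral_eq_Suc atLeastAtMostSuc_conv)

lemma sum_weight_total: "sum weight {1..10} = 120"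
  unfolding atLeastAtMost_1_10 by (simp add: weight_def)

text \<open>The property for which the weights were chosen, verified by evaluation. The
  \<open>filter\<close> yields the complement, again in increasing order.\<close>

lemma tie_lists:
  "\<forall>xs\<in>set (sublists_with_sum weight [1,2,3,4,5,6,7,8,9,10] 5 60).
     xs \<in> set design_lists \<or> filter (\<lambda>i. i \<notin> set xs) [1,2,3,4,5,6,7,8,9,10] \<in> set design_lists"
  by code_simp

lemma tie_cases:
  assumes "A \<subseteq> {1..10}" "card A = 5" "sum weight A = 60"
  shows "A \<in> design_sets \<or> {1..10} - A \<in> design_sets"
proof -
  define L :: "nat list" where "L = [1,2,3,4,5,6,7,8,9,10]"
  have L: "set L = {1..10}" "distinct L"
    unfolding L_def atLeastAtMost_1_10 by simp_all
  have "A \<in> set ` set (subseqs L)"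
    by (rule subset_subseqs) (simp only: L(1) assms(1))
  then obtain xs where sub: "xs \<in> set (subseqs L)" and set: "set xs = A"
    by (elim imageE) blast
  have compl: "set (filter (\<lambda>i. i \<notin> set xs) L) = {1..10} - A"
    by (simp only: set_filter L(1) set set_diff_eq)
  have "distinct xs" by (rule subseqs_distinctD[OF sub L(2)])
  then have "length xs = 5" "sum_list (map weight xs) = 60"
    using assms set by (auto simp: distinct_card[symmetric] sum_list_distinct_conv_sum_set)
  then have "xs \<in> set design_lists \<or> filter (\<lambda>i. i \<notin> set xs) L \<in> set design_lists"
    using tie_lists[folded L_def] mem_sublists_with_sum[OF sub] by blast
  then have "set xs \<in> design_sets \<or> set (filter (\<lambda>i. i \<notin> set xs) L) \<in> design_sets"
    unfolding design_sets_def list.set_map by blast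
  then show ?thesis unfolding compl unfolding set .
qed

lemma design_sets_eq:
  "design_sets = {{1,2,3,4,5}, {1,2,6,7,8}, {1,3,6,9,10}, {2,4,7,9,10}, {3,5,7,8,9}, {4,5,6,8,10}}"
  by (simp add: design_sets_def design_lists_def)

lemma design_lists_distinct: "distinct (map set design_lists)"
  by code_simp

lemma sum_design_sets: "sum f design_sets = sum_list (map (f \<circ> set) design_lists)"
  using sum.distinct_set_conv_list[OF design_lists_distinct, of f]
  by (simp add: design_sets_def)

lemma design_setsD:
  assumes "A \<in> design_sets"
  shows "A \<subseteq> {1..10}" "card A = 5" "sum weight A = 60"
  using assms unfolding design_sets_eq by (auto simp: weight_def)

lemma design_sets_multiplicity:
  assumes "w \<in> {1..10}"
  shows "card {A\<in>design_sets. w \<in> A} = 3"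
proof -
  have "card {A\<in>design_sets. w \<in> A} = (\<Sum>A\<in>design_sets. if w \<in> A then 1 else 0)"
    by (simp add: design_sets_def flip: sum.inter_filter)
  then show ?thesis
    using assms unfolding atLeastAtMost_1_10 sum_design_sets design_lists_def by auto
qed

lemma card_design_sets: "card design_sets = 6"
  using distinct_card[OF design_lists_distinct] by (simp add: design_sets_def design_lists_def)

text \<open>Two points of the design share two blocks, so any two of the six sets meet, while a set
  and its complement do not.\<close>

lemma design_set_compl_not_design:
  assumes "A \<in> design_sets"
  shows "{1..10} - A \<notin> design_sets"
proof -
  have "\<forall>xs\<in>set design_lists. \<forall>ys\<in>set design_lists. set xs \<inter> set ys \<noteq> {}"
    by code_simp
  then show ?thesis
    using assms unfolding design_sets_def by fastforce
qed

section \<open>The lower bound six\<close>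

lemma design_multiplicity_bound:
  fixes A :: "'i \<Rightarrow> nat set"
  assumes K: "finite K" "K \<noteq> {}"
    and A: "\<And>i. i \<in> K \<Longrightarrow> A i \<in> design_sets"
    and eq: "\<And>w. w \<in> {1..10} \<Longrightarrow> 2 * card {i\<in>K. w \<in> A i} = card K"
  shows "card K \<ge> 6"
proof -
  define n where "n s = card {i\<in>K. A i = s}" for s
  have fin: "finite design_sets" by (simp add: design_sets_def)
  have count: "card {i\<in>K. P (A i)} = sum_list (map ((\<lambda>s. if P s then n s else 0) \<circ> set) design_lists)"
    for P
    using card_multiplicity_by_value[where A = A and P = P, OF K(1) fin A]
    unfolding n_def sum_design_sets by simp
  have total: "card K = sum_list (map (n \<circ> set) design_lists)"
    using count[where P = "\<lambda>_. True"] by (simp add: comp_def)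
  have mult: "2 * sum_list (map ((\<lambda>s. if w \<in> s then n s else 0) \<circ> set) design_lists) = card K"
    if "w \<in> {1..10}" for w
    using eq[OF that] count[where P = "\<lambda>s. w \<in> s"] by simp
  \<comment> \<open>The equations for 1 to 5 make the last five sets equally frequent, say
    \<open>m\<close> times each. If the first occurs \<open>a\<close> times, \<open>card K\<close>
    is both \<open>a + 5 * m\<close> and \<open>2 * a + 4 * m\<close>, so
    \<open>a = m\<close>.\<close>
  have "card K = 6 * n {1,2,3,4,5}"
    using total mult[of 1] mult[of 2] mult[of 3] mult[of 4] mult[of 5]
    by (simp add: design_lists_def)
  moreover have "card K > 0" using K by (simp add: card_gt_0_iff)
  ultimately show ?thesis by simp
qed

lemma heavyD:
  assumes "A \<in> heavy"
  shows "A \<subseteq> {1..10}" "card A \<ge> 5"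
  using assms unfolding heavy_def heavy5_def by auto

text \<open>Averaging by size and then by weight leaves only design sets. The general index set
  covers both subfamilies indexed by themselves and the sequences in \<open>phi\<close>.\<close>

lemma heavy_multiplicity_bound:
  fixes A :: "'i \<Rightarrow> nat set"
  assumes K: "finite K" "K \<noteq> {}"
    and A: "\<And>i. i \<in> K \<Longrightarrow> A i \<in> heavy"
    and le: "\<And>w. w \<in> {1..10} \<Longrightarrow> 2 * card {i\<in>K. w \<in> A i} \<le> card K"
  shows "card K \<ge> 6"
proof -
  let ?m = "\<lambda>w. card {i\<in>K. w \<in> A i}"
  have sub: "A i \<subseteq> {1..10}" if "i \<in> K" for i
    using heavyD A that by blast
  have cards: "sum ?m {1..10} = (\<Sum>i\<in>K. card (A i))"
    using sum_weighted_multiplicity[where A = A, OF K(1) finite_atLeastAtMost sub, where f = "\<lambda>_. 1 :: nat"] by simp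
  have "(\<Sum>w\<in>{1..10}. 2 * ?m w) \<le> (\<Sum>w\<in>{1..10::nat}. card K)"
    using le by (intro sum_mono) auto
  then have upper: "(\<Sum>w\<in>{1..10}. ?m w) \<le> 5 * card K"
    by (simp flip: sum_distrib_left)
  have lower: "(\<Sum>i\<in>K. card (A i)) \<ge> (\<Sum>i\<in>K. 5)"
    using heavyD A by (intro sum_mono) auto
  \<comment> \<open>The multiplicity bound at ten points limits the average size to 5, and heavy
    sets have at least 5 elements; hence both bounds are attained everywhere.\<close>
  have "(\<Sum>i\<in>K. 5) = (\<Sum>i\<in>K. card (A i))"
    using upper lower cards by simp
  then have card5: "card (A i) = 5" if "i \<in> K" for i
    using sum_mono_inv[of "\<lambda>_. 5" K "\<lambda>i. card (A i)" i] heavyD A K that by fastforce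
  have "(\<Sum>w\<in>{1..10}. 2 * ?m w) = (\<Sum>w\<in>{1..10::nat}. card K)"
    using cards card5 by (simp flip: sum_distrib_left)
  then have eq: "2 * ?m w = card K" if "w \<in> {1..10}" for w
    using sum_mono_inv[of "\<lambda>w. 2 * ?m w" "{1..10}" "\<lambda>_. card K" w] le that by fastforce
  \<comment> \<open>With all multiplicities equal to \<open>card K / 2\<close>, the average weight
    is 60. No member of \<open>heavy5\<close> is below 60, so all are ties and hence design
    sets.\<close>
  have "2 * (\<Sum>i\<in>K. sum weight (A i)) = 2 * (\<Sum>w\<in>{1..10}. of_nat (?m w) * weight w)"
    by (subst sum_weighted_multiplicity[OF K(1) finite_atLeastAtMost sub]) auto
  also have "\<dots> = (\<Sum>w\<in>{1..10}. of_nat (2 * ?m w) * weight w)"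
    by (simp add: sum_distrib_left mult.assoc)
  also have "\<dots> = (\<Sum>w\<in>{1..10}. of_nat (card K) * weight w)"
    using eq by (intro sum.cong) auto
  also have "\<dots> = 2 * (\<Sum>i\<in>K. 60)"
    using sum_weight_total by (simp flip: sum_distrib_left)
  finally have weights: "(\<Sum>i\<in>K. 60) = (\<Sum>i\<in>K. sum weight (A i))"
    by simp
  have five: "A i \<in> heavy5" if "i \<in> K" for i
    using A[OF that] card5[OF that] unfolding heavy_def by auto
  then have ge: "sum weight (A i) \<ge> 60" if "i \<in> K" for i
    using that design_setsD(3) unfolding heavy5_def by fastforce
  have "sum weight (A i) = 60" if "i \<in> K" for i
    using sum_mono_inv[OF weights ge that K(1)] by simp
  then have "A i \<in> design_sets" if "i \<in> K" for i
    using five[OF that] that unfolding heavy5_def by auto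
  then show ?thesis
    using K eq by (intro design_multiplicity_bound) auto
qed

section \<open>Complementary pairs of 5-sets\<close>

lemma weight_compl:
  assumes "A \<subseteq> {1..10}"
  shows "sum weight ({1..10} - A) = 120 - sum weight A"
  using sum_diff[OF finite_atLeastAtMost assms, of weight] sum_weight_total by simp

lemma card_compl:
  assumes "A \<subseteq> {1..10::nat}"
  shows "card ({1..10} - A) = 10 - card A"
  using assms by (simp add: card_Diff_subset finite_subset)

text \<open>The two weights add up to 120: either just one exceeds 60, or both equal 60 and just one
  side is a design set. Both the count 126 and the maximality of the frame follow from this.\<close>

lemma heavy5_compl_iff:
  assumes "A \<subseteq> {1..10}" "card A = 5"
  shows "{1..10} - A \<in> heavy5 \<longleftrightarrow> A \<notin> heavy5"
proof -
  have compl: "{1..10} - ({1..10} - A) = A" using assms(1) by blast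
  have "A \<in> design_sets \<or> {1..10} - A \<in> design_sets" if "sum weight A = 60"
    using tie_cases assms that by blast
  moreover have "sum weight A = 60" if "A \<in> design_sets \<or> {1..10} - A \<in> design_sets"
    using that weight_compl[OF assms(1)] design_setsD(3) by fastforce
  moreover have "\<not> (A \<in> design_sets \<and> {1..10} - A \<in> design_sets)"
    using design_set_compl_not_design by blast
  ultimately show ?thesis
    using weight_compl[OF assms(1)] card_compl[OF assms(1)] assms unfolding heavy5_def
    by (cases "sum weight A" "60 :: int" rule: linorder_cases) auto
qed

lemma card_heavy5: "card heavy5 = 126"
proof -
  let ?U = "{1..10::nat}"
  let ?L = "{A. A \<subseteq> ?U \<and> card A = 5}"
  let ?C = "\<lambda>A. ?U - A"
  have sub: "heavy5 \<subseteq> ?L" unfolding heavy5_def by auto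
  have finL: "finite ?L" by simp
  \<comment> \<open>Complementation exchanges \<open>heavy5\<close> with the remaining 5-sets, so it
    contains half of all 252.\<close>
  have "?C ` heavy5 = ?L - heavy5"
  proof (rule set_eqI, rule iffI)
    fix B assume "B \<in> ?C ` heavy5"
    then obtain A where "A \<in> heavy5" "B = ?U - A" by blast
    then show "B \<in> ?L - heavy5"
      using sub heavy5_compl_iff[of A] card_compl[of A] by auto
  next
    fix B assume B: "B \<in> ?L - heavy5"
    then have "B = ?C (?C B)" "?C B \<in> heavy5"
      using heavy5_compl_iff[of B] by auto
    then show "B \<in> ?C ` heavy5" by blast
  qed
  moreover have "inj_on ?C heavy5"
    by (rule inj_on_inverseI[where g = ?C]) (use sub in auto)
  ultimately have "card heavy5 = card (?L - heavy5)"
    by (metis card_image)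
  moreover have "card (?L - heavy5) = card ?L - card heavy5"
    using sub finL by (intro card_Diff_subset) (auto intro: finite_subset)
  moreover have "card ?L = 10 choose 5"
    using n_subsets[of ?U 5] by simp
  moreover have "(10::nat) choose 5 = 252" by (simp add: numeral_eq_Suc)
  ultimately show ?thesis using card_mono[OF finL sub] by simp
qed

section \<open>Balanced subfamilies\<close>

lemma heavy5_balanced_bound:
  assumes "G \<subseteq> heavy5" "balanced 5 G" "card G > 0"
  shows "card G \<ge> 6"
proof -
  have G: "finite G" "G \<noteq> {}" using assms(3) card_gt_0_iff by blast+
  have memb: "A \<subseteq> {1..10}" "card A = 5" if "A \<in> G" for A
    using assms(1) that unfolding heavy5_def by auto
  obtain c where c: "\<And>i. i \<in> {1..10} \<Longrightarrow> card {A\<in>G. i \<in> A} = c"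
    using assms(2) unfolding balanced_def by auto
  \<comment> \<open>Double counting shows that \<open>c\<close> is half of
    \<open>card G\<close>.\<close>
  have "10 * c = (\<Sum>w\<in>{1..10::nat}. card {A\<in>G. w \<in> A})"
    using c by simp
  also have "\<dots> = (\<Sum>A\<in>G. card A)"
    using sum_weighted_multiplicity[OF G(1) finite_atLeastAtMost, where A = "\<lambda>A. A" and f = "\<lambda>_. 1 :: nat"] memb
    by simp
  also have "\<dots> = 5 * card G"
    using memb by simp
  finally have "2 * c = card G" by simp
  then show ?thesis
    using G c assms(1)
    by (intro heavy_multiplicity_bound[of G "\<lambda>A. A"]) (auto simp: heavy_def)
qed

lemma design_sets_heavy5: "design_sets \<subseteq> heavy5"
  using design_setsD unfolding heavy5_def by blast

lemma balanced_design_sets: "balanced 5 design_sets"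
  using design_setsD(1) design_sets_multiplicity unfolding balanced_def by auto

section \<open>The maximal frame and its index\<close>

lemma undecided_heavy: "undecided {1..10} heavy = {}"
proof -
  have "A \<in> heavy \<or> {1..10} - A \<in> heavy" if "A \<subseteq> {1..10}" for A
  proof (cases "card A" "5 :: nat" rule: linorder_cases)
    case less
    then show ?thesis using card_compl[OF that] unfolding heavy_def by auto
  next
    case equal
    then show ?thesis using heavy5_compl_iff that unfolding heavy_def by auto
  next
    case greater
    then show ?thesis using that unfolding heavy_def by auto
  qed
  then show ?thesis unfolding undecided_def by auto
qed

lemma maximal_frame_heavy: "maximal_frame 5 heavy"
proof -
  have level: "level 5 heavy = heavy5"
    unfolding level_def heavy_def heavy5_def by auto
  have "standard_frame 5 heavy"
    using heavyD unfolding standard_frame_def decision_frame_def by (auto simp: heavy_def)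
  moreover have "{1..10} - A \<notin> heavy5" if "A \<in> heavy5" for A
  proof -
    have "A \<subseteq> {1..10}" "card A = 5" using that unfolding heavy5_def by auto
    then show ?thesis using heavy5_compl_iff that by blast
  qed
  ultimately show ?thesis
    unfolding maximal_frame_def level using undecided_heavy by auto
qed

text \<open>As no set is undecided, the conclusion of \<open>phi\<close> fails for every positive
  \<open>k\<close>, so \<open>phi\<close> just denies its premises. For \<open>k = 0\<close> the
  conclusion is vacuous.\<close>

lemma phi_heavy_iff:
  "phi {1..10} heavy k A \<longleftrightarrow>
     \<not> ((\<forall>i\<in>{1..k}. A i \<in> heavy) \<and> (\<forall>w\<in>{1..10}. 2 * card {i\<in>{1..k}. w \<in> A i} \<le> k)) \<or> k = 0"
proof -
  have "(real c \<le> real k / 2) = (2 * c \<le> k)" for c by linarith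
  then show ?thesis
    unfolding phi_def undecided_heavy by (cases "k = 0") auto
qed

text \<open>Any enumeration of the six design sets is a violation: each number lies in three of
  them, which meets the bound \<open>6 / 2\<close>.\<close>

lemma not_phi_heavy_6:
  "\<exists>A. (\<forall>i\<in>{1..6}. A i \<subseteq> {1..10}) \<and> \<not> phi {1..10} heavy 6 A"
proof -
  obtain A where A: "bij_betw A {1..6::nat} design_sets"
    using finite_same_card_bij[of "{1..6::nat}" design_sets] card_design_sets
    by (auto simp: design_sets_def)
  have "card {i\<in>{1..6}. w \<in> A i} = 3" if "w \<in> {1..10}" for w
  proof -
    have "A ` {i\<in>{1..6}. w \<in> A i} = {s\<in>design_sets. w \<in> s}"
      unfolding bij_betw_imp_surj_on[OF A, symmetric] by blast
    moreover have "inj_on A {i\<in>{1..6}. w \<in> A i}"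
      by (rule inj_on_subset[OF bij_betw_imp_inj_on[OF A]]) blast
    ultimately show ?thesis
      using card_image design_sets_multiplicity[OF that] by fastforce
  qed
  moreover have "A i \<in> heavy" if "i \<in> {1..6}" for i
    using bij_betwE[OF A] that design_sets_heavy5 unfolding heavy_def by blast
  ultimately show ?thesis
    unfolding phi_heavy_iff using heavyD(1) by (intro exI[of _ A]) auto
qed

lemma not_phi_heavy_bound:
  assumes "\<not> phi {1..10} heavy k A"
  shows "k \<ge> 6"
  using heavy_multiplicity_bound[of "{1..k}" A] assms unfolding phi_heavy_iff by auto

lemma frame_index_heavy: "frame_index {1..10} heavy = 6"
  unfolding frame_index_def
  using not_phi_heavy_6 not_phi_heavy_bound by (intro Least_equality) auto

lemma incoherent_heavy: "\<not> coherent {1..10} heavy"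
  using not_phi_heavy_6 unfolding coherent_def
  by (metis one_le_numeral)

theorem propositionB24:
  "(\<exists>F :: nat set set.
      (\<forall>A\<in>F. A \<subseteq> {1..10} \<and> card A = 5) \<and>
      real (card F) = 1 / 2 * real (10 choose 5) \<and> card F = 126 \<and>
      \<not> (\<exists>G\<subseteq>F. card G = 2 \<and> balanced 5 G) \<and>
      \<not> (\<exists>G\<subseteq>F. card G = 4 \<and> balanced 5 G) \<and>
      (\<exists>G\<subseteq>F. card G = 6 \<and> balanced 5 G))
   \<and>
   (\<exists>M :: nat set set.
      maximal_frame 5 M \<and> \<not> coherent {1..10} M \<and> frame_index {1..10} M = 6)"
proof (intro conjI)
  have choose: "(10::nat) choose 5 = 252" by (simp add: numeral_eq_Suc)
  have "A \<subseteq> {1..10} \<and> card A = 5" if "A \<in> heavy5" for A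
    using that unfolding heavy5_def by blast
  moreover have small: "\<not> (\<exists>G\<subseteq>heavy5. card G = k \<and> balanced 5 G)" if "0 < k" "k < 6" for k
    using heavy5_balanced_bound that by (metis leD)
  moreover have "\<exists>G\<subseteq>heavy5. card G = 6 \<and> balanced 5 G"
    using design_sets_heavy5 card_design_sets balanced_design_sets by blast
  ultimately show "\<exists>F :: nat set set.
      (\<forall>A\<in>F. A \<subseteq> {1..10} \<and> card A = 5) \<and>
      real (card F) = 1 / 2 * real (10 choose 5) \<and> card F = 126 \<and>
      \<not> (\<exists>G\<subseteq>F. card G = 2 \<and> balanced 5 G) \<and>
      \<not> (\<exists>G\<subseteq>F. card G = 4 \<and> balanced 5 G) \<and>
      (\<exists>G\<subseteq>F. card G = 6 \<and> balanced 5 G)"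
    using card_heavy5 choose small[of 2] small[of 4] by (intro exI[of _ heavy5]) simp
  show "\<exists>M :: nat set set.
      maximal_frame 5 M \<and> \<not> coherent {1..10} M \<and> frame_index {1..10} M = 6"
    using maximal_frame_heavy incoherent_heavy frame_index_heavy by blast
qed

end
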